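(* Let $\alpha\in\mathbb{R}^M$, $\beta\in\mathbb{R}^N$ be strictly positive probability vectors and let $c:\mathbb{R}^d\times\mathbb{R}^d\to\mathbb{R}_+$ be continuous. Let $X=(x_1,\dots,x_M):[0,1]\to(\mathbb{R}^d)^M$ and $Y=(y_1,\dots,y_N):[0,1]\to(\mathbb{R}^d)^N$ be continuous curves such that: (i) for each $t\in(0,1)$ and any distinct indices $i\ne j$, $x_i(t)\ne x_j(t)$ and $y_i(t)\ne y_j(t)$; (ii) for each $t\in[0,1]$, the $c$-cost optimal transport problem between $\rho_{X(t)}$ and $\mu_{Y(t)}$ has a unique solution. Then there exists $\hat\gamma\in\Pi(\alpha,\beta)$ such that for all $t\in[0,1]$ the unique optimal plan between $\rho_{X(t)}$ and $\mu_{Y(t)}$ is $$\gamma(t)=\sum_{i=1}^M\sum_{j=1}^N\hat\gamma_{ij}\,\delta_{(x_i(t),y_j(t))}.$$ In other words, given the optimal plan $\gamma(s)$ for some $s\in(0,1)$, the unique optimal plan for each other $t\in[0,1]$ is a glue-composition $\pi^\rho_{ts}\circ\gamma(s)\circ\pi^\mu_{st}$, where $$\pi^\rho_{ts}=\sum_{i=1}^M\alpha_i\delta_{(x_i(t),x_i(s))}\in\Pi(\rho_{X(t)},\rho_{X(s)}),\qquad\pi^\mu_{st}=\sum_{j=1}^N\beta_j\delta_{(y_j(s),y_j(t))}\in\Pi(\mu_{Y(s)},\mu_{Y(t)}).$$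
   Context: For $X\in(\mathbb{R}^d)^M$, $Y\in(\mathbb{R}^d)^N$: $\rho_X=\sum_{i=1}^M\alpha_i\delta_{x_i}$, $\mu_Y=\sum_{j=1}^N\beta_j\delta_{y_j}$. $\Pi(\alpha,\beta)=\{\hat\gamma\in\mathbb{R}^{M\times N}:\hat\gamma_{ij}\ge0,\ \sum_{i}\hat\gamma_{ij}=\beta_j,\ \sum_j\hat\gamma_{ij}=\alpha_i\}$; for measures, $\Pi(\rho,\mu)$ is the set of couplings of $\rho$ and $\mu$. The $c$-cost transport problem minimises $\int c\,\mathrm{d}\gamma$ over $\gamma\in\Pi(\rho_{X(t)},\mu_{Y(t)})$; uniqueness is uniqueness of the minimising measure. A measure $\gamma_1\in\Pi(\rho_{X(t)},\mu_{Y(t)})$ is a glue-composition of $\pi^\rho_{ts},\gamma(s),\pi^\mu_{st}$ if there is a probability measure $\eta$ on $(\mathbb{R}^d)^4$ with marginals $\rho_{X(t)},\rho_{X(s)},\mu_{Y(s)},\mu_{Y(t)}$ whose projections onto coordinates $(1,2)$, $(2,3)$, $(3,4)$, $(1,4)$ are respectively $\pi^\rho_{ts}$, $\gamma(s)$, $\pi^\mu_{st}$, $\gamma_1$ (glue-compositions need not be unique in general). *)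

theory Defs
  imports "HOL-Probability.Probability"
begin

text \<open>The finite combination of Dirac masses \<open>\<Sum>i. a i \<cdot> \<delta>(x i)\<close> as a Borel measure. There is no
  addition on the type of measures, so the sum is taken setwise; \<open>ennreal\<close> would truncate
  negative weights to 0, but only nonnegative weights are used.\<close>

definition dirac_sum :: "('i::finite \<Rightarrow> real) \<Rightarrow> ('i \<Rightarrow> 'a::topological_space) \<Rightarrow> 'a measure" where
  "dirac_sum a x =
     measure_of UNIV (sets borel) (\<lambda>A. \<Sum>i\<in>UNIV. ennreal (a i) * emeasure (return borel (x i)) A)"

lemma space_dirac_sum [simp]: "space (dirac_sum a x) = UNIV"
  by (simp add: dirac_sum_def space_measure_of_conv)

lemma sets_dirac_sum [simp, measurable_cong]: "sets (dirac_sum a x) = sets borel"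
  using sets.sigma_sets_eq[of borel] by (simp add: dirac_sum_def)

lemma emeasure_dirac_sum:
  fixes a :: "'i::finite \<Rightarrow> real" and x :: "'i \<Rightarrow> 'a::topological_space"
  assumes "A \<in> sets borel"
  shows "emeasure (dirac_sum a x) A = (\<Sum>i\<in>UNIV. ennreal (a i) * indicator A (x i))"
proof -
  let ?f = "\<lambda>A. \<Sum>i\<in>UNIV. ennreal (a i) * emeasure (return borel (x i)) A"
  have "emeasure (dirac_sum a x) A = ?f A"
  proof (rule emeasure_measure_of[OF dirac_sum_def])
    show "sets borel \<subseteq> Pow (UNIV :: 'a set)" by simp
    show "A \<in> sets (dirac_sum a x)" using assms by simp
    show "positive (sets (dirac_sum a x)) ?f" by (simp add: positive_def)
    show "countably_additive (sets (dirac_sum a x)) ?f"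
    proof (rule countably_additiveI)
      fix B :: "nat \<Rightarrow> 'a set"
      assume B: "range B \<subseteq> sets (dirac_sum a x)" "disjoint_family B"
      have "(\<Sum>n. ?f (B n)) = (\<Sum>i\<in>UNIV. \<Sum>n. ennreal (a i) * emeasure (return borel (x i)) (B n))"
        by (rule suminf_sum) simp
      also have "\<dots> = ?f (\<Union>n. B n)"
        using B by (intro sum.cong refl) (simp add: suminf_emeasure image_subset_iff del: emeasure_return)
      finally show "(\<Sum>n. ?f (B n)) = ?f (\<Union>n. B n)" .
    qed
  qed
  then show ?thesis using assms by simp
qed

text \<open>The discrete plans \<open>\<Pi>(\<alpha>, \<beta>)\<close>.\<close>

definition discrete_couplings :: "real ^ 'm \<Rightarrow> real ^ 'n \<Rightarrow> (real ^ 'n ^ 'm) set" where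
  "discrete_couplings \<alpha> \<beta> =
     {g. (\<forall>i j. 0 \<le> g $ i $ j) \<and>
         (\<forall>j. (\<Sum>i\<in>UNIV. g $ i $ j) = \<beta> $ j) \<and>
         (\<forall>i. (\<Sum>j\<in>UNIV. g $ i $ j) = \<alpha> $ i)}"

definition couplings ::
    "'a::topological_space measure \<Rightarrow> 'b::topological_space measure \<Rightarrow> ('a \<times> 'b) measure set" where
  "couplings \<rho> \<mu> =
     {\<gamma>. sets \<gamma> = sets borel \<and> distr \<gamma> borel fst = \<rho> \<and> distr \<gamma> borel snd = \<mu>}"

definition transport_cost :: "('a \<times> 'b \<Rightarrow> real) \<Rightarrow> ('a \<times> 'b) measure \<Rightarrow> ennreal" where
  "transport_cost c \<gamma> = (\<integral>\<^sup>+ z. ennreal (c z) \<partial>\<gamma>)"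

definition optimal_plan ::
    "('a::topological_space \<times> 'b::topological_space \<Rightarrow> real) \<Rightarrow> 'a measure \<Rightarrow> 'b measure \<Rightarrow>
     ('a \<times> 'b) measure \<Rightarrow> bool" where
  "optimal_plan c \<rho> \<mu> \<gamma> \<longleftrightarrow>
     \<gamma> \<in> couplings \<rho> \<mu> \<and> (\<forall>\<gamma>'\<in>couplings \<rho> \<mu>. transport_cost c \<gamma> \<le> transport_cost c \<gamma>')"

text \<open>\<open>\<gamma>\<^sub>1\<close> is a glue-composition of \<open>\<pi>\<^sub>\<rho>\<close>, \<open>\<gamma>\<close>, \<open>\<pi>\<^sub>\<mu>\<close>, where the four coordinates of the gluing
  measure \<open>\<eta>\<close> have marginals \<open>\<rho>\<^sub>1\<close>, \<open>\<rho>\<^sub>2\<close>, \<open>\<mu>\<^sub>2\<close>, \<open>\<mu>\<^sub>1\<close> in this order.\<close>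

definition glue_composition ::
    "'a::topological_space measure \<Rightarrow> 'a measure \<Rightarrow> 'a measure \<Rightarrow> 'a measure \<Rightarrow>
     ('a \<times> 'a) measure \<Rightarrow> ('a \<times> 'a) measure \<Rightarrow> ('a \<times> 'a) measure \<Rightarrow> ('a \<times> 'a) measure \<Rightarrow> bool" where
  "glue_composition \<rho>\<^sub>1 \<rho>\<^sub>2 \<mu>\<^sub>2 \<mu>\<^sub>1 \<pi>\<^sub>\<rho> \<gamma> \<pi>\<^sub>\<mu> \<gamma>\<^sub>1 \<longleftrightarrow>
     \<gamma>\<^sub>1 \<in> couplings \<rho>\<^sub>1 \<mu>\<^sub>1 \<and>
     (\<exists>\<eta> :: ('a \<times> 'a \<times> 'a \<times> 'a) measure.
        prob_space \<eta> \<and> sets \<eta> = sets borel \<and>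
        distr \<eta> borel (\<lambda>(z\<^sub>1, z\<^sub>2, z\<^sub>3, z\<^sub>4). z\<^sub>1) = \<rho>\<^sub>1 \<and>
        distr \<eta> borel (\<lambda>(z\<^sub>1, z\<^sub>2, z\<^sub>3, z\<^sub>4). z\<^sub>2) = \<rho>\<^sub>2 \<and>
        distr \<eta> borel (\<lambda>(z\<^sub>1, z\<^sub>2, z\<^sub>3, z\<^sub>4). z\<^sub>3) = \<mu>\<^sub>2 \<and>
        distr \<eta> borel (\<lambda>(z\<^sub>1, z\<^sub>2, z\<^sub>3, z\<^sub>4). z\<^sub>4) = \<mu>\<^sub>1 \<and>
        distr \<eta> borel (\<lambda>(z\<^sub>1, z\<^sub>2, z\<^sub>3, z\<^sub>4). (z\<^sub>1, z\<^sub>2)) = \<pi>\<^sub>\<rho> \<and>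
        distr \<eta> borel (\<lambda>(z\<^sub>1, z\<^sub>2, z\<^sub>3, z\<^sub>4). (z\<^sub>2, z\<^sub>3)) = \<gamma> \<and>
        distr \<eta> borel (\<lambda>(z\<^sub>1, z\<^sub>2, z\<^sub>3, z\<^sub>4). (z\<^sub>3, z\<^sub>4)) = \<pi>\<^sub>\<mu> \<and>
        distr \<eta> borel (\<lambda>(z\<^sub>1, z\<^sub>2, z\<^sub>3, z\<^sub>4). (z\<^sub>1, z\<^sub>4)) = \<gamma>\<^sub>1)"

text \<open>For a configuration \<open>X\<close> of \<open>M\<close> points with weights \<open>\<alpha>\<close>: \<open>config_measure \<alpha> X\<close> is
  \<open>\<rho>\<^sub>X = \<Sum>i. \<alpha>\<^sub>i \<delta>(x\<^sub>i)\<close>, \<open>config_plan g X Y\<close> is \<open>\<Sum>i j. g\<^sub>i\<^sub>j \<delta>(x\<^sub>i, y\<^sub>j)\<close>, and \<open>config_transition \<alpha> X X'\<close>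
  is the diagonal plan \<open>\<Sum>i. \<alpha>\<^sub>i \<delta>(x\<^sub>i, x'\<^sub>i)\<close>.\<close>

definition config_measure :: "real ^ 'm \<Rightarrow> ('a::topological_space) ^ 'm \<Rightarrow> 'a measure" where
  "config_measure \<alpha> X = dirac_sum (\<lambda>i. \<alpha> $ i) (\<lambda>i. X $ i)"

definition config_plan ::
    "real ^ 'n ^ 'm \<Rightarrow> ('a::topological_space) ^ 'm \<Rightarrow> ('b::topological_space) ^ 'n \<Rightarrow> ('a \<times> 'b) measure" where
  "config_plan g X Y = dirac_sum (\<lambda>(i, j). g $ i $ j) (\<lambda>(i, j). (X $ i, Y $ j))"

definition config_transition ::
    "real ^ 'm \<Rightarrow> ('a::topological_space) ^ 'm \<Rightarrow> 'a ^ 'm \<Rightarrow> ('a \<times> 'a) measure" where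
  "config_transition \<alpha> X X' = dirac_sum (\<lambda>i. \<alpha> $ i) (\<lambda>i. (X $ i, X' $ i))"

end

theory Submission
  imports Defs
begin

text \<open>Every plan between the configurations at time \<open>t\<close>, also one where points collide, comes from a
  matrix in \<open>\<Pi>(\<alpha>, \<beta>)\<close>, so the problem at time \<open>t\<close> is to minimise a linear functional, continuous in \<open>t\<close>,
  over the fixed polytope \<open>\<Pi>(\<alpha>, \<beta>)\<close>. For \<open>t \<in> (0, 1)\<close> the matrix of a plan is determined by the plan,
  hence the minimiser is unique and is a vertex. The polytope has finitely many vertices, and
  the times at which a given vertex is optimal form a closed set, so by connectedness the optimal vertex
  is constant on \<open>(0, 1)\<close>; it remains optimal at the endpoints by continuity.\<close>

section \<open>Finite sums of Dirac masses: values, images and integrals\<close>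

lemma sum_UNIV_prod:
  "(\<Sum>p\<in>UNIV. f p) = (\<Sum>i\<in>UNIV. \<Sum>j\<in>UNIV. f (i, j))"
  by (simp add: sum.cartesian_product' flip: UNIV_Times_UNIV)

lemma measure_dirac_sum:
  assumes "\<And>i. 0 \<le> a i" and "A \<in> sets borel"
  shows "measure (dirac_sum a x) A = (\<Sum>i\<in>UNIV. a i * indicator A (x i))"
proof -
  have "emeasure (dirac_sum a x) A = ennreal (\<Sum>i\<in>UNIV. a i * indicator A (x i))"
    using assms by (simp add: emeasure_dirac_sum ennreal_mult ennreal_indicator flip: sum_ennreal)
  then show ?thesis
    using assms by (simp add: measure_def sum_nonneg)
qed

lemma finite_measure_dirac_sum: "finite_measure (dirac_sum a x)"
proof (rule finite_measureI)
  have "emeasure (dirac_sum a x) (space (dirac_sum a x)) = (\<Sum>i\<in>UNIV. ennreal (a i))"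
    by (simp add: emeasure_dirac_sum)
  also have "\<dots> \<noteq> \<infinity>"
    by simp
  finally show "emeasure (dirac_sum a x) (space (dirac_sum a x)) \<noteq> \<infinity>" .
qed

lemma prob_space_dirac_sum:
  assumes "\<And>i. 0 \<le> a i" "(\<Sum>i\<in>UNIV. a i) = 1"
  shows "prob_space (dirac_sum a x)"
  using assms by (intro prob_spaceI) (simp add: emeasure_dirac_sum sum_ennreal)

lemma distr_dirac_sum:
  assumes [measurable]: "f \<in> borel_measurable borel"
  shows "distr (dirac_sum a x) borel f = dirac_sum a (\<lambda>i. f (x i))"
proof (rule measure_eqI)
  fix A assume "A \<in> sets (distr (dirac_sum a x) borel f)"
  then have [measurable]: "A \<in> sets borel"
    by simp
  have "f \<in> measurable (dirac_sum a x) borel"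
    by measurable
  moreover have "f -` A \<in> sets borel"
    using measurable_sets[OF assms \<open>A \<in> sets borel\<close>] by simp
  ultimately show "emeasure (distr (dirac_sum a x) borel f) A =
      emeasure (dirac_sum a (\<lambda>i. f (x i))) A"
    by (simp add: emeasure_distr emeasure_dirac_sum indicator_def)
qed simp

text \<open>Gives access to integration: against the image of a weighted counting measure, an
  integral becomes a finite sum over indices.\<close>

lemma dirac_sum_eq_distr:
  "dirac_sum a x = distr (density (count_space UNIV) (\<lambda>i. ennreal (a i))) borel x"
proof (rule measure_eqI)
  fix A assume "A \<in> sets (dirac_sum a x)"
  then have A: "A \<in> sets borel"
    by simp
  have "emeasure (distr (density (count_space UNIV) (\<lambda>i. ennreal (a i))) borel x) A
      = (\<integral>\<^sup>+ i. ennreal (a i) * indicator (x -` A) i \<partial>count_space UNIV)"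
    using A by (simp add: emeasure_distr emeasure_density)
  then show "emeasure (dirac_sum a x) A =
      emeasure (distr (density (count_space UNIV) (\<lambda>i. ennreal (a i))) borel x) A"
    using A by (simp add: emeasure_dirac_sum nn_integral_count_space_finite indicator_def)
qed simp

lemma nn_integral_dirac_sum:
  assumes "f \<in> borel_measurable borel"
  shows "(\<integral>\<^sup>+ z. f z \<partial>dirac_sum a x) = (\<Sum>i\<in>UNIV. ennreal (a i) * f (x i))"
  unfolding dirac_sum_eq_distr using assms
  by (simp add: nn_integral_distr nn_integral_density nn_integral_count_space_finite)

section \<open>Projections and marginals of discrete plans\<close>

lemma borel_measurable_fst_borel [measurable]:
  "(fst :: 'a::topological_space \<times> 'b::topological_space \<Rightarrow> 'a) \<in> borel_measurable borel"
  by (intro borel_measurable_continuous_onI continuous_intros)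

lemma borel_measurable_snd_borel [measurable]:
  "(snd :: 'a::topological_space \<times> 'b::topological_space \<Rightarrow> 'b) \<in> borel_measurable borel"
  by (intro borel_measurable_continuous_onI continuous_intros)

text \<open>The atom depends on \<open>i\<close> only, so summing out \<open>j\<close> leaves the
  row sum. The map \<open>f\<close> is left general because gluing also needs it with pairs of
  points as values.\<close>

lemma discrete_couplings_row_marginal:
  assumes "g \<in> discrete_couplings \<alpha> \<beta>"
  shows "dirac_sum (\<lambda>(i, j). g $ i $ j) (\<lambda>(i, j). f i) = dirac_sum (($) \<alpha>) f"
proof (rule measure_eqI)
  fix A assume "A \<in> sets (dirac_sum (\<lambda>(i, j). g $ i $ j) (\<lambda>(i, j). f i))"
  then have A: "A \<in> sets borel"
    by simp
  have "(\<Sum>j\<in>UNIV. ennreal (g $ i $ j)) = ennreal (\<alpha> $ i)" for i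
    using assms by (simp add: discrete_couplings_def sum_ennreal)
  then show "emeasure (dirac_sum (\<lambda>(i, j). g $ i $ j) (\<lambda>(i, j). f i)) A = emeasure (dirac_sum (($) \<alpha>) f) A"
    using A by (simp add: emeasure_dirac_sum sum_UNIV_prod
        del: sum_mult_indicator flip: sum_distrib_right)
qed simp

lemma discrete_couplings_column_marginal:
  assumes "g \<in> discrete_couplings \<alpha> \<beta>"
  shows "dirac_sum (\<lambda>(i, j). g $ i $ j) (\<lambda>(i, j). f j) = dirac_sum (($) \<beta>) f"
proof (rule measure_eqI)
  fix A assume "A \<in> sets (dirac_sum (\<lambda>(i, j). g $ i $ j) (\<lambda>(i, j). f j))"
  then have A: "A \<in> sets borel"
    by simp
  have *: "(\<Sum>i\<in>UNIV. ennreal (g $ i $ j)) = ennreal (\<beta> $ j)" for j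
    using assms by (simp add: discrete_couplings_def sum_ennreal)
  have "emeasure (dirac_sum (\<lambda>(i, j). g $ i $ j) (\<lambda>(i, j). f j)) A =
      (\<Sum>i\<in>UNIV. \<Sum>j\<in>UNIV. ennreal (g $ i $ j) * indicator A (f j))"
    using A by (simp add: emeasure_dirac_sum sum_UNIV_prod del: sum_mult_indicator)
  also have "\<dots> = (\<Sum>j\<in>UNIV. \<Sum>i\<in>UNIV. ennreal (g $ i $ j) * indicator A (f j))"
    by (rule sum.swap)
  also have "\<dots> = emeasure (dirac_sum (($) \<beta>) f) A"
    using A by (simp add: emeasure_dirac_sum * del: sum_mult_indicator flip: sum_distrib_right)
  finally show "emeasure (dirac_sum (\<lambda>(i, j). g $ i $ j) (\<lambda>(i, j). f j)) A = emeasure (dirac_sum (($) \<beta>) f) A" .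
qed simp

lemma discrete_couplings_sum:
  assumes "g \<in> discrete_couplings \<alpha> \<beta>"
  shows "(\<Sum>(i, j)\<in>UNIV. g $ i $ j) = (\<Sum>i\<in>UNIV. \<alpha> $ i)"
  using assms
  by (simp add: discrete_couplings_def sum_UNIV_prod)

lemma config_plan_coupling:
  assumes "g \<in> discrete_couplings \<alpha> \<beta>"
  shows "config_plan g X Y \<in> couplings (config_measure \<alpha> X) (config_measure \<beta> Y)"
  using discrete_couplings_row_marginal[OF assms, of "($) X"]
    discrete_couplings_column_marginal[OF assms, of "($) Y"]
  by (simp add: couplings_def config_plan_def config_measure_def distr_dirac_sum case_prod_unfold)

lemma config_transition_coupling:
  "config_transition \<alpha> X X' \<in> couplings (config_measure \<alpha> X) (config_measure \<alpha> X')"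
  by (simp add: couplings_def config_transition_def config_measure_def distr_dirac_sum)

section \<open>Plans and matrices: linear cost, injectivity and surjectivity of
  \<open>config_plan\<close>\<close>

definition cost_matrix ::
    "('a \<times> 'b \<Rightarrow> real) \<Rightarrow> 'a ^ 'm \<Rightarrow> 'b ^ 'n \<Rightarrow> real ^ 'n ^ 'm" where
  "cost_matrix c X Y = (\<chi> i j. c (X $ i, Y $ j))"

lemma transport_cost_config_plan:
  assumes c: "c \<in> borel_measurable borel" "\<And>z. 0 \<le> c z" and g: "g \<in> discrete_couplings \<alpha> \<beta>"
  shows "transport_cost c (config_plan g X Y) = ennreal (cost_matrix c X Y \<bullet> g)"
proof -
  have g0: "0 \<le> g $ i $ j" for i j
    using g by (simp add: discrete_couplings_def)
  have "transport_cost c (config_plan g X Y) =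
      (\<Sum>p\<in>UNIV. ennreal (g $ fst p $ snd p * c (X $ fst p, Y $ snd p)))"
    using c g0
    by (simp add: transport_cost_def config_plan_def nn_integral_dirac_sum case_prod_unfold ennreal_mult)
  also have "\<dots> = ennreal (\<Sum>p\<in>UNIV. g $ fst p $ snd p * c (X $ fst p, Y $ snd p))"
    using c g0 by (intro sum_ennreal) simp
  also have "(\<Sum>p\<in>UNIV. g $ fst p $ snd p * c (X $ fst p, Y $ snd p)) = cost_matrix c X Y \<bullet> g"
    by (simp add: inner_vec_def cost_matrix_def sum_UNIV_prod mult.commute)
  finally show ?thesis .
qed

text \<open>With distinct points, the location \<open>(X $ i, Y $ j)\<close> comes from the index
  pair \<open>(i, j)\<close> alone, so the mass of this singleton is the matrix entry.\<close>

lemma config_plan_inject: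
  fixes X :: "'a::t2_space ^ 'm" and Y :: "'b::t2_space ^ 'n"
  assumes X: "\<And>i j. i \<noteq> j \<Longrightarrow> X $ i \<noteq> X $ j" and Y: "\<And>i j. i \<noteq> j \<Longrightarrow> Y $ i \<noteq> Y $ j"
    and g: "\<And>i j. 0 \<le> g $ i $ j" and h: "\<And>i j. 0 \<le> h $ i $ j"
    and eq: "config_plan g X Y = config_plan h X Y"
  shows "g = h"
proof -
  have inj_X: "i = j" if "X $ i = X $ j" for i j
    using X that by blast
  have inj_Y: "i = j" if "Y $ i = Y $ j" for i j
    using Y that by blast
  have *: "measure (config_plan k X Y) {(X $ i, Y $ j)} = k $ i $ j"
    if "\<And>i j. 0 \<le> k $ i $ j" for k :: "real ^ 'n ^ 'm" and i j
  proof -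
    have "measure (config_plan k X Y) {(X $ i, Y $ j)} =
        (\<Sum>p\<in>UNIV. k $ fst p $ snd p * indicator {(X $ i, Y $ j)} (X $ fst p, Y $ snd p))"
      using that by (simp add: config_plan_def measure_dirac_sum case_prod_unfold)
    also have "\<dots> = (\<Sum>p\<in>UNIV. if p = (i, j) then k $ i $ j else 0)"
      by (intro sum.cong) (auto simp: indicator_def dest: inj_X inj_Y)
    finally show ?thesis
      by simp
  qed
  show ?thesis
    using *[OF g] *[OF h] eq by (simp add: vec_eq_iff)
qed

text \<open>On each fibre of \<open>x\<close> the normalised weights sum to 1, so summing over
  indices with these weights counts every value of \<open>x\<close> exactly once.\<close>

lemma sum_fibre_weights:
  fixes a :: "'i::finite \<Rightarrow> real" and \<phi> :: "'a \<Rightarrow> real"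
  assumes "\<And>i. 0 < a i"
  shows "(\<Sum>i\<in>UNIV. \<phi> (x i) * (a i / (\<Sum>k | x k = x i. a k))) = (\<Sum>u\<in>range x. \<phi> u)"
proof -
  have "(\<Sum>i\<in>UNIV. \<phi> (x i) * (a i / (\<Sum>k | x k = x i. a k))) =
      (\<Sum>u\<in>range x. \<Sum>i | x i = u. \<phi> (x i) * (a i / (\<Sum>k | x k = x i. a k)))"
    by (subst sum.image_gen[where g = x]) simp_all
  also have "\<dots> = (\<Sum>u\<in>range x. \<phi> u)"
  proof (rule sum.cong[OF refl])
    fix u assume "u \<in> range x"
    then have "{i. x i = u} \<noteq> {}"
      by auto
    then have "(\<Sum>k | x k = u. a k) > 0"
      using assms by (intro sum_pos) auto
    then show "(\<Sum>i | x i = u. \<phi> (x i) * (a i / (\<Sum>k | x k = x i. a k))) = \<phi> u"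
      by (simp flip: sum_distrib_left sum_divide_distrib)
  qed
  finally show ?thesis .
qed

text \<open>If points of the configurations coincide, the mass that \<open>\<gamma>\<close> gives to a pair of locations is
  split among the pairs of indices there in proportion to \<open>\<alpha>\<^sub>i \<beta>\<^sub>j\<close>.\<close>

lemma coupling_is_config_plan:
  fixes X :: "'a::t2_space ^ 'm" and Y :: "'b::t2_space ^ 'n"
  assumes \<alpha>: "\<And>i. 0 < \<alpha> $ i" and \<beta>: "\<And>j. 0 < \<beta> $ j"
    and \<gamma>: "\<gamma> \<in> couplings (config_measure \<alpha> X) (config_measure \<beta> Y)"
  shows "\<exists>g\<in>discrete_couplings \<alpha> \<beta>. \<gamma> = config_plan g X Y"
proof -
  \<comment> \<open>\<open>r\<close> and \<open>m\<close> are the total masses at a location;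
    \<open>p i\<close> and \<open>q j\<close> are the shares of a single index in the mass at its
    location.\<close>
  define r where "r u = (\<Sum>k | X $ k = u. \<alpha> $ k)" for u
  define m where "m v = (\<Sum>k | Y $ k = v. \<beta> $ k)" for v
  define p where "p i = \<alpha> $ i / r (X $ i)" for i
  define q where "q j = \<beta> $ j / m (Y $ j)" for j
  define g where "g = (\<chi> i j. measure \<gamma> {(X $ i, Y $ j)} * p i * q j)"
  have sets_\<gamma> [simp, measurable_cong]: "sets \<gamma> = sets borel"
    and fst_\<gamma>: "distr \<gamma> borel fst = config_measure \<alpha> X"
    and snd_\<gamma>: "distr \<gamma> borel snd = config_measure \<beta> Y"
    using \<gamma> by (auto simp: couplings_def)
  have space_\<gamma> [simp]: "space \<gamma> = UNIV"
    using sets_eq_imp_space_eq[OF sets_\<gamma>] by simp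
  have [measurable]: "fst \<in> borel_measurable \<gamma>" "snd \<in> borel_measurable \<gamma>"
    by measurable
  have vimage_fst: "(fst -` U :: ('a \<times> 'b) set) \<in> sets borel" if "U \<in> sets borel" for U
    using measurable_sets[OF borel_measurable_fst_borel that] by simp
  have vimage_snd: "(snd -` V :: ('a \<times> 'b) set) \<in> sets borel" if "V \<in> sets borel" for V
    using measurable_sets[OF borel_measurable_snd_borel that] by simp
  \<comment> \<open>Membership in \<open>couplings\<close> does not state finiteness; the total mass
    is read off the first marginal.\<close>
  interpret finite_measure \<gamma>
  proof (rule finite_measureI)
    have "emeasure \<gamma> (space \<gamma>) = emeasure (distr \<gamma> borel fst) UNIV"
      by (simp add: emeasure_distr)
    also have "\<dots> \<noteq> \<infinity>"
      using finite_measure.emeasure_finite[OF finite_measure_dirac_sum]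
      by (simp add: fst_\<gamma> config_measure_def)
    finally show "emeasure \<gamma> (space \<gamma>) \<noteq> \<infinity>" .
  qed
  have fst_meas: "measure \<gamma> (fst -` U) = (\<Sum>i\<in>UNIV. \<alpha> $ i * indicator U (X $ i))"
    if "U \<in> sets borel" for U
    using that measure_distr[of fst \<gamma> borel U] \<alpha>
    by (simp add: fst_\<gamma> config_measure_def measure_dirac_sum less_imp_le)
  have snd_meas: "measure \<gamma> (snd -` U) = (\<Sum>i\<in>UNIV. \<beta> $ i * indicator U (Y $ i))"
    if "U \<in> sets borel" for U
    using that measure_distr[of snd \<gamma> borel U] \<beta>
    by (simp add: snd_\<gamma> config_measure_def measure_dirac_sum less_imp_le)
  define S where "S = range (($) X) \<times> range (($) Y)"
  have fin: "finite (range (($) X))" "finite (range (($) Y))" "finite S"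
    by (auto simp: S_def)
  \<comment> \<open>A point outside the grid \<open>S\<close> has a coordinate outside one of the
    two finite supports, where the corresponding marginal vanishes.\<close>
  have null: "measure \<gamma> (- S) = 0"
  proof -
    have "- S = fst -` (- range (($) X)) \<union> snd -` (- range (($) Y))"
      by (auto simp: S_def)
    moreover have "- range (($) X) \<in> sets borel" "- range (($) Y) \<in> sets borel"
      using fin by (auto intro!: borel_open finite_imp_closed)
    moreover from this have "measure \<gamma> (fst -` (- range (($) X))) = 0"
      "measure \<gamma> (snd -` (- range (($) Y))) = 0"
      by (auto simp: fst_meas snd_meas)
    ultimately show ?thesis
      using measure_Un_le[of "fst -` (- range (($) X))" \<gamma> "snd -` (- range (($) Y))"]
      by (simp add: vimage_fst vimage_snd order_antisym)
  qed
  have S_sets: "T \<in> sets borel" if "T \<subseteq> S" for T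
    using finite_subset[OF that fin(3)] by (intro borel_closed finite_imp_closed)
  \<comment> \<open>Being concentrated on the finite set \<open>S\<close>, the coupling is the sum
    of its atoms.\<close>
  have \<gamma>_eq: "measure \<gamma> A = (\<Sum>u\<in>range (($) X). \<Sum>v\<in>range (($) Y). measure \<gamma> {(u, v)} * indicator A (u, v))"
    if A: "A \<in> sets borel" for A
  proof -
    have "measure \<gamma> A = measure \<gamma> (A \<inter> S) + measure \<gamma> (A \<inter> - S)"
      using finite_measure_Union[of "A \<inter> S" "A \<inter> - S"] A S_sets[of S]
      by (auto simp: Int_Un_distrib[symmetric] sets.Int borel_comp)
    also have "measure \<gamma> (A \<inter> - S) = 0"
      using finite_measure_mono[of "A \<inter> - S" "- S"] S_sets[of S] null
      by (auto simp: borel_comp order_antisym)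
    also have "measure \<gamma> (A \<inter> S) = (\<Sum>z\<in>A \<inter> S. measure \<gamma> {z})"
      using fin S_sets by (intro finite_measure_eq_sum_singleton) auto
    also have "\<dots> = (\<Sum>z\<in>S. measure \<gamma> {z} * indicator A z)"
      using fin by (intro sum.mono_neutral_cong_left) (auto simp: indicator_def)
    finally show ?thesis
      by (simp add: S_def sum.cartesian_product')
  qed
  have X_sum: "(\<Sum>i\<in>UNIV. \<phi> (X $ i) * p i) = (\<Sum>u\<in>range (($) X). \<phi> u)" for \<phi>
    unfolding p_def r_def by (rule sum_fibre_weights[OF \<alpha>])
  have Y_sum: "(\<Sum>j\<in>UNIV. \<phi> (Y $ j) * q j) = (\<Sum>v\<in>range (($) Y). \<phi> v)" for \<phi>
    unfolding q_def m_def by (rule sum_fibre_weights[OF \<beta>])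
  have r_pos: "r (X $ i) > 0" for i
    unfolding r_def using \<alpha> by (intro sum_pos) auto
  have m_pos: "m (Y $ j) > 0" for j
    unfolding m_def using \<beta> by (intro sum_pos) auto
  have g0: "0 \<le> g $ i $ j" for i j
    using \<alpha> \<beta> r_pos m_pos by (simp add: g_def p_def q_def less_imp_le)
  \<comment> \<open>The strip over \<open>X $ i\<close> has mass \<open>r (X $ i)\<close> by the
    first marginal, and is also the sum of its atoms. Index \<open>i\<close> receives the share
    \<open>p i\<close> of it, which is \<alpha> at \<open>i\<close>.\<close>
  have row: "(\<Sum>j\<in>UNIV. g $ i $ j) = \<alpha> $ i" for i
  proof -
    have "measure \<gamma> (fst -` {X $ i}) = r (X $ i)"
      by (simp add: fst_meas r_def indicator_def if_distrib sum.If_cases cong: if_cong)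
    moreover have "measure \<gamma> (fst -` {X $ i}) =
        (\<Sum>u\<in>range (($) X). \<Sum>v\<in>range (($) Y). if u = X $ i then measure \<gamma> {(X $ i, v)} else 0)"
      unfolding \<gamma>_eq[OF vimage_fst[OF borel_singleton[OF sets.empty_sets]]]
      by (intro sum.cong refl) (simp add: indicator_def)
    moreover have "\<dots> = (\<Sum>v\<in>range (($) Y). measure \<gamma> {(X $ i, v)})"
      by (subst sum.swap) simp
    moreover have "(\<Sum>j\<in>UNIV. g $ i $ j) = p i * (\<Sum>j\<in>UNIV. measure \<gamma> {(X $ i, Y $ j)} * q j)"
      by (simp add: g_def sum_distrib_left mult_ac)
    ultimately show ?thesis
      using r_pos[of i] Y_sum[of "\<lambda>v. measure \<gamma> {(X $ i, v)}"] by (simp add: p_def)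
  qed
  have col: "(\<Sum>i\<in>UNIV. g $ i $ j) = \<beta> $ j" for j
  proof -
    have "measure \<gamma> (snd -` {Y $ j}) = m (Y $ j)"
      by (simp add: snd_meas m_def indicator_def if_distrib sum.If_cases cong: if_cong)
    moreover have "measure \<gamma> (snd -` {Y $ j}) =
        (\<Sum>u\<in>range (($) X). \<Sum>v\<in>range (($) Y). if v = Y $ j then measure \<gamma> {(u, Y $ j)} else 0)"
      unfolding \<gamma>_eq[OF vimage_snd[OF borel_singleton[OF sets.empty_sets]]]
      by (intro sum.cong refl) (simp add: indicator_def)
    moreover have "\<dots> = (\<Sum>u\<in>range (($) X). measure \<gamma> {(u, Y $ j)})"
      by simp
    moreover have "(\<Sum>i\<in>UNIV. g $ i $ j) = q j * (\<Sum>i\<in>UNIV. measure \<gamma> {(X $ i, Y $ j)} * p i)"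
      by (simp add: g_def sum_distrib_left mult_ac)
    ultimately show ?thesis
      using m_pos[of j] X_sum[of "\<lambda>u. measure \<gamma> {(u, Y $ j)}"] by (simp add: q_def)
  qed
  have "\<gamma> = config_plan g X Y"
  proof (rule measure_eqI)
    fix A assume "A \<in> sets \<gamma>"
    then have A: "A \<in> sets borel"
      by simp
    interpret plan: finite_measure "config_plan g X Y"
      unfolding config_plan_def by (rule finite_measure_dirac_sum)
    have "measure (config_plan g X Y) A = (\<Sum>i\<in>UNIV. \<Sum>j\<in>UNIV. g $ i $ j * indicator A (X $ i, Y $ j))"
      using A g0 by (simp add: config_plan_def measure_dirac_sum case_prod_unfold sum_UNIV_prod del: sum_mult_indicator)
    \<comment> \<open>The shares are moved outwards so that \<open>Y_sum\<close> collapses the inner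
      sum to locations, and then \<open>X_sum\<close> the outer one.\<close>
    also have "\<dots> = (\<Sum>i\<in>UNIV. (\<Sum>j\<in>UNIV.
        (measure \<gamma> {(X $ i, Y $ j)} * indicator A (X $ i, Y $ j)) * q j) * p i)"
      by (simp add: g_def sum_distrib_left mult_ac)
    also have "\<dots> = (\<Sum>i\<in>UNIV. (\<Sum>v\<in>range (($) Y).
        measure \<gamma> {(X $ i, v)} * indicator A (X $ i, v)) * p i)"
      by (subst Y_sum) simp
    also have "\<dots> = measure \<gamma> A"
      by (subst X_sum) (simp add: \<gamma>_eq[OF A])
    finally show "emeasure \<gamma> A = emeasure (config_plan g X Y) A"
      by (simp add: emeasure_eq_measure plan.emeasure_eq_measure)
  qed (simp add: config_plan_def)
  moreover have "g \<in> discrete_couplings \<alpha> \<beta>"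
    using g0 row col by (simp add: discrete_couplings_def)
  ultimately show ?thesis
    by blast
qed

text \<open>Every coupling is a \<open>config_plan\<close>, so the transport problem is a linear
  programme over matrices. This covers colliding points too; several matrices may then describe the
  same plan.\<close>

lemma optimal_plan_config_iff:
  fixes X :: "'a::t2_space ^ 'm" and Y :: "'b::t2_space ^ 'n"
  assumes \<alpha>: "\<And>i. 0 < \<alpha> $ i" and \<beta>: "\<And>j. 0 < \<beta> $ j"
    and c: "c \<in> borel_measurable borel" "\<And>z. 0 \<le> c z"
  shows "optimal_plan c (config_measure \<alpha> X) (config_measure \<beta> Y) \<gamma> \<longleftrightarrow>
    (\<exists>g\<in>discrete_couplings \<alpha> \<beta>. \<gamma> = config_plan g X Y \<and>
      (\<forall>h\<in>discrete_couplings \<alpha> \<beta>. cost_matrix c X Y \<bullet> g \<le> cost_matrix c X Y \<bullet> h))"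
proof -
  let ?K = "discrete_couplings \<alpha> \<beta>" and ?C = "cost_matrix c X Y"
  have couplings: "couplings (config_measure \<alpha> X) (config_measure \<beta> Y) = (\<lambda>g. config_plan g X Y) ` ?K"
    using coupling_is_config_plan[OF \<alpha> \<beta>] config_plan_coupling by fastforce
  \<comment> \<open>Since \<open>ennreal\<close> truncates negative numbers, it reflects the order
    of the costs only once they are known to be nonnegative.\<close>
  have "0 \<le> ?C \<bullet> h" if "h \<in> ?K" for h
    using that c(2) by (auto simp: inner_vec_def cost_matrix_def discrete_couplings_def intro!: sum_nonneg)
  then have "transport_cost c (config_plan g X Y) \<le> transport_cost c (config_plan h X Y) \<longleftrightarrow>
      ?C \<bullet> g \<le> ?C \<bullet> h" if "g \<in> ?K" "h \<in> ?K" for g h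
    using that by (simp add: transport_cost_config_plan[OF c] ennreal_le_iff)
  then show ?thesis
    unfolding optimal_plan_def couplings by auto
qed

section \<open>Linear minimisation over a polyhedron\<close>

lemma polyhedron_discrete_couplings: "polyhedron (discrete_couplings \<alpha> \<beta>)"
proof -
  \<comment> \<open>The matrix units: the inner product with \<open>?E i j\<close> extracts an
    entry, which turns the constraints into finitely many half-spaces and hyperplanes.\<close>
  let ?E = "\<lambda>i j. axis i (axis j 1) :: real ^ 'n ^ 'm"
  have eq: "discrete_couplings \<alpha> \<beta> =
      (\<Inter>i. \<Inter>j. {g. ?E i j \<bullet> g \<ge> 0}) \<inter>
      (\<Inter>j. {g. (\<Sum>i\<in>UNIV. ?E i j) \<bullet> g = \<beta> $ j}) \<inter>
      (\<Inter>i. {g. (\<Sum>j\<in>UNIV. ?E i j) \<bullet> g = \<alpha> $ i})"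
    by (auto simp: discrete_couplings_def inner_axis' inner_sum_left)
  show ?thesis
    unfolding eq
    by (intro polyhedron_Int polyhedron_Inter)
      (auto intro!: polyhedron_Inter polyhedron_halfspace_ge polyhedron_hyperplane)
qed

text \<open>The minimisers of a linear functional form the face cut out by a supporting hyperplane;
  uniqueness shrinks this face to a point.\<close>

lemma unique_minimiser_extreme_point:
  fixes K :: "'a::euclidean_space set"
  assumes "convex K" "g \<in> K" "\<And>h. h \<in> K \<Longrightarrow> a \<bullet> g \<le> a \<bullet> h"
    and "\<And>h. h \<in> K \<Longrightarrow> a \<bullet> h = a \<bullet> g \<Longrightarrow> h = g"
  shows "g extreme_point_of K"
proof -
  have "(K \<inter> {x. a \<bullet> x = a \<bullet> g}) face_of K"
    using assms by (intro face_of_Int_supporting_hyperplane_ge) auto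
  moreover have "K \<inter> {x. a \<bullet> x = a \<bullet> g} = {g}"
    using assms by auto
  ultimately show ?thesis
    by (simp add: face_of_singleton)
qed

text \<open>A map with finite range and relatively closed fibres is continuous, hence constant on a
  connected set; this is applied to the minimiser as a function of \<open>t\<close>. Existence of
  minimisers is part of \<open>ex1\<close>, as a polyhedron may be unbounded.\<close>

lemma constant_unique_minimiser:
  fixes K :: "'a::euclidean_space set" and a :: "'t::topological_space \<Rightarrow> 'a"
  assumes K: "polyhedron K" and T: "connected T" and a: "continuous_on T a"
    and ex1: "\<And>t. t \<in> T \<Longrightarrow> \<exists>!g. g \<in> K \<and> (\<forall>h\<in>K. a t \<bullet> g \<le> a t \<bullet> h)"
    and "T \<noteq> {}"
  shows "\<exists>g\<in>K. \<forall>t\<in>T. \<forall>h\<in>K. a t \<bullet> g \<le> a t \<bullet> h"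
proof -
  obtain G where G: "\<And>t. t \<in> T \<Longrightarrow> G t \<in> K" "\<And>t h. t \<in> T \<Longrightarrow> h \<in> K \<Longrightarrow> a t \<bullet> G t \<le> a t \<bullet> h"
    using ex1 by metis
  have G_unique: "g = G t" if "t \<in> T" "g \<in> K" "\<And>h. h \<in> K \<Longrightarrow> a t \<bullet> g \<le> a t \<bullet> h" for t g
    using ex1[OF that(1)] that G by blast
  have "G t extreme_point_of K" if "t \<in> T" for t
  proof (rule unique_minimiser_extreme_point[OF polyhedron_imp_convex[OF K], where a = "a t"])
    show "h = G t" if "h \<in> K" "a t \<bullet> h = a t \<bullet> G t" for h
      using that G(2)[OF \<open>t \<in> T\<close>] by (intro G_unique[OF \<open>t \<in> T\<close>]) simp_all
  qed (use G that in simp_all)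
  then have "G ` T \<subseteq> {g. g extreme_point_of K}"
    by (simp add: image_subset_iff)
  then have fin: "finite (G ` T)"
    by (rule finite_subset) (rule finite_polyhedron_extreme_points[OF K])
  have closed: "closedin (top_of_set T) {t \<in> T. G t = g}" if "g \<in> K" for g
  proof -
    \<comment> \<open>Uniqueness replaces the equation by weak inequalities between functions
      continuous in \<open>t\<close>, so the fibre is an intersection of closed sets.\<close>
    have "G t = g \<longleftrightarrow> (\<forall>h\<in>K. a t \<bullet> g \<le> a t \<bullet> h)" if "t \<in> T" for t
      using G(2)[OF that] G_unique[OF that \<open>g \<in> K\<close>] by metis
    then have "{t \<in> T. G t = g} = (\<Inter>h\<in>K. {t \<in> T. a t \<bullet> g \<le> a t \<bullet> h})"
      using that by auto
    moreover have "closedin (top_of_set T) {t \<in> T. a t \<bullet> g \<le> a t \<bullet> h}" for h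
    proof -
      have "{t \<in> T. a t \<bullet> g \<le> a t \<bullet> h} = T \<inter> (\<lambda>t. a t \<bullet> h - a t \<bullet> g) -` {0..}"
        by auto
      then show ?thesis
        using a by (auto intro!: continuous_closedin_preimage continuous_intros)
    qed
    ultimately show ?thesis
      using that by (auto intro!: closedin_INT)
  qed
  have "continuous_on T G"
    unfolding continuous_on_closed
  proof (intro allI impI)
    fix U assume "closedin (top_of_set (G ` T)) U"
    \<comment> \<open>Only finitely many values occur, so the preimage is a finite union of closed
      fibres.\<close>
    have "T \<inter> G -` U = (\<Union>g\<in>U \<inter> G ` T. {t \<in> T. G t = g})"
      by auto
    moreover have "closedin (top_of_set T) (\<Union>g\<in>U \<inter> G ` T. {t \<in> T. G t = g})"
      using fin G closed by (intro closedin_Union) auto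
    ultimately show "closedin (top_of_set T) (T \<inter> G -` U)"
      by simp
  qed
  then have "connected (G ` T)"
    using T by (rule connected_continuous_image)
  then obtain g where "\<And>t. t \<in> T \<Longrightarrow> G t = g"
    using fin connected_finite_iff_sing[of "G ` T"] by (metis empty_iff image_eqI singletonD)
  moreover obtain t\<^sub>0 where "t\<^sub>0 \<in> T"
    using \<open>T \<noteq> {}\<close> by blast
  ultimately show ?thesis
    using G by (metis (no_types))
qed

section \<open>Gluing along the labelled points\<close>

lemma glue_composition_config_plan:
  fixes X X' :: "'a::topological_space ^ 'm" and Y Y' :: "'a ^ 'n"
  assumes g: "g \<in> discrete_couplings \<alpha> \<beta>" and sum: "(\<Sum>i\<in>UNIV. \<alpha> $ i) = 1"
  shows "glue_composition (config_measure \<alpha> X') (config_measure \<alpha> X)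
    (config_measure \<beta> Y) (config_measure \<beta> Y')
    (config_transition \<alpha> X' X) (config_plan g X Y) (config_transition \<beta> Y Y')
    (config_plan g X' Y')"
proof -
  \<comment> \<open>Mass \<open>g $ i $ j\<close> sits on the quadruple of positions of the labels
    \<open>i\<close> and \<open>j\<close> in both pairs of configurations, so labels are kept even
    where points collide.\<close>
  define \<eta> where "\<eta> = dirac_sum (\<lambda>(i, j). g $ i $ j) (\<lambda>(i, j). (X' $ i, X $ i, Y $ j, Y' $ j))"
  \<comment> \<open>Continuity yields measurability for the Borel sets of the product topology,
    which in a general topological space may exceed the product sigma-algebra.\<close>
  have distr_\<eta>: "distr \<eta> borel f =
      dirac_sum (\<lambda>(i, j). g $ i $ j) (\<lambda>(i, j). f (X' $ i, X $ i, Y $ j, Y' $ j))"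
    if "continuous_on UNIV f" for f :: "'a \<times> 'a \<times> 'a \<times> 'a \<Rightarrow> 'b::topological_space"
    using that by (simp add: \<eta>_def distr_dirac_sum borel_measurable_continuous_onI case_prod_unfold)
  have "prob_space \<eta>"
    unfolding \<eta>_def using g discrete_couplings_sum[OF g] sum
    by (intro prob_space_dirac_sum) (auto simp: discrete_couplings_def)
  moreover have "sets \<eta> = sets borel"
    by (simp add: \<eta>_def)
  moreover have "distr \<eta> borel (\<lambda>(z\<^sub>1, z\<^sub>2, z\<^sub>3, z\<^sub>4). z\<^sub>1) = config_measure \<alpha> X'"
    "distr \<eta> borel (\<lambda>(z\<^sub>1, z\<^sub>2, z\<^sub>3, z\<^sub>4). z\<^sub>2) = config_measure \<alpha> X"
    "distr \<eta> borel (\<lambda>(z\<^sub>1, z\<^sub>2, z\<^sub>3, z\<^sub>4). z\<^sub>3) = config_measure \<beta> Y"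
    "distr \<eta> borel (\<lambda>(z\<^sub>1, z\<^sub>2, z\<^sub>3, z\<^sub>4). z\<^sub>4) = config_measure \<beta> Y'"
    "distr \<eta> borel (\<lambda>(z\<^sub>1, z\<^sub>2, z\<^sub>3, z\<^sub>4). (z\<^sub>1, z\<^sub>2)) = config_transition \<alpha> X' X"
    "distr \<eta> borel (\<lambda>(z\<^sub>1, z\<^sub>2, z\<^sub>3, z\<^sub>4). (z\<^sub>2, z\<^sub>3)) = config_plan g X Y"
    "distr \<eta> borel (\<lambda>(z\<^sub>1, z\<^sub>2, z\<^sub>3, z\<^sub>4). (z\<^sub>3, z\<^sub>4)) = config_transition \<beta> Y Y'"
    "distr \<eta> borel (\<lambda>(z\<^sub>1, z\<^sub>2, z\<^sub>3, z\<^sub>4). (z\<^sub>1, z\<^sub>4)) = config_plan g X' Y'"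
    by (subst distr_\<eta>;
        ((unfold case_prod_unfold, intro continuous_intros; fail) |
         (simp add: config_measure_def config_transition_def config_plan_def
            discrete_couplings_row_marginal[OF g] discrete_couplings_column_marginal[OF g])))+
  ultimately show ?thesis
    unfolding glue_composition_def using config_plan_coupling[OF g] by blast
qed

section \<open>Constancy of the optimal matrix in time\<close>

theorem theorem4p4:
  fixes \<alpha> :: "real ^ 'm" and \<beta> :: "real ^ 'n"
    and c :: "(real ^ 'd) \<times> (real ^ 'd) \<Rightarrow> real"
    and X :: "real \<Rightarrow> (real ^ 'd) ^ 'm" and Y :: "real \<Rightarrow> (real ^ 'd) ^ 'n"
  assumes alpha_pos: "\<And>i. 0 < \<alpha> $ i" and alpha_sum: "(\<Sum>i\<in>UNIV. \<alpha> $ i) = 1"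
    and beta_pos: "\<And>j. 0 < \<beta> $ j" and beta_sum: "(\<Sum>j\<in>UNIV. \<beta> $ j) = 1"
    and c_nonneg: "\<And>z. 0 \<le> c z" and c_cont: "continuous_on UNIV c"
    and X_cont: "continuous_on {0..1} X" and Y_cont: "continuous_on {0..1} Y"
    and X_distinct: "\<And>t i j. t \<in> {0<..<1} \<Longrightarrow> i \<noteq> j \<Longrightarrow> X t $ i \<noteq> X t $ j"
    and Y_distinct: "\<And>t i j. t \<in> {0<..<1} \<Longrightarrow> i \<noteq> j \<Longrightarrow> Y t $ i \<noteq> Y t $ j"
    and unique: "\<And>t. t \<in> {0..1} \<Longrightarrow>
      \<exists>!\<gamma>. optimal_plan c (config_measure \<alpha> (X t)) (config_measure \<beta> (Y t)) \<gamma>"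
  shows "(\<exists>g\<in>discrete_couplings \<alpha> \<beta>. \<forall>t\<in>{0..1}. \<forall>\<gamma>.
            optimal_plan c (config_measure \<alpha> (X t)) (config_measure \<beta> (Y t)) \<gamma> \<longleftrightarrow>
            \<gamma> = config_plan g (X t) (Y t)) \<and>
    (\<forall>s\<in>{0<..<1}. \<forall>t\<in>{0..1}. t \<noteq> s \<longrightarrow>
       config_transition \<alpha> (X t) (X s)
         \<in> couplings (config_measure \<alpha> (X t)) (config_measure \<alpha> (X s)) \<and>
       config_transition \<beta> (Y s) (Y t)
         \<in> couplings (config_measure \<beta> (Y s)) (config_measure \<beta> (Y t)) \<and>
       (\<forall>\<gamma>s \<gamma>t.
          optimal_plan c (config_measure \<alpha> (X s)) (config_measure \<beta> (Y s)) \<gamma>s \<longrightarrow>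
          optimal_plan c (config_measure \<alpha> (X t)) (config_measure \<beta> (Y t)) \<gamma>t \<longrightarrow>
          glue_composition
            (config_measure \<alpha> (X t)) (config_measure \<alpha> (X s))
            (config_measure \<beta> (Y s)) (config_measure \<beta> (Y t))
            (config_transition \<alpha> (X t) (X s)) \<gamma>s (config_transition \<beta> (Y s) (Y t)) \<gamma>t))"
proof -
  let ?K = "discrete_couplings \<alpha> \<beta>"
  let ?opt = "\<lambda>t. optimal_plan c (config_measure \<alpha> (X t)) (config_measure \<beta> (Y t))"
  define a where "a t = cost_matrix c (X t) (Y t)" for t
  have "c \<in> borel_measurable borel"
    using c_cont by (rule borel_measurable_continuous_onI)
  then have opt_iff: "?opt t \<gamma> \<longleftrightarrow>
      (\<exists>g\<in>?K. \<gamma> = config_plan g (X t) (Y t) \<and> (\<forall>h\<in>?K. a t \<bullet> g \<le> a t \<bullet> h))" for t \<gamma>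
    unfolding a_def using alpha_pos beta_pos c_nonneg by (intro optimal_plan_config_iff)
  have a_cont: "continuous_on {0..1} a"
    unfolding a_def cost_matrix_def
    by (intro continuous_on_vec_lambda continuous_on_compose2[OF c_cont] continuous_intros X_cont Y_cont)
      auto
  \<comment> \<open>Uniqueness of the plan passes to the matrix by
    \<open>config_plan_inject\<close>. This is where distinctness enters, and why the endpoints are
    left out here.\<close>
  have ex1: "\<exists>!g. g \<in> ?K \<and> (\<forall>h\<in>?K. a t \<bullet> g \<le> a t \<bullet> h)" if t: "t \<in> {0<..<1}" for t
  proof (rule ex_ex1I)
    have t': "t \<in> {0..1}"
      using t by simp
    show "\<exists>g. g \<in> ?K \<and> (\<forall>h\<in>?K. a t \<bullet> g \<le> a t \<bullet> h)"
      using unique[OF t'] by (auto simp: opt_iff)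
    fix g h assume g: "g \<in> ?K \<and> (\<forall>k\<in>?K. a t \<bullet> g \<le> a t \<bullet> k)"
      and h: "h \<in> ?K \<and> (\<forall>k\<in>?K. a t \<bullet> h \<le> a t \<bullet> k)"
    then have "?opt t (config_plan g (X t) (Y t))" "?opt t (config_plan h (X t) (Y t))"
      unfolding opt_iff by blast+
    then have "config_plan g (X t) (Y t) = config_plan h (X t) (Y t)"
      using unique[OF t'] by blast
    then show "g = h"
      using g h by (intro config_plan_inject[OF X_distinct[OF t] Y_distinct[OF t]])
        (auto simp: discrete_couplings_def)
  qed
  have a_cont': "continuous_on {0<..<1} a"
    using a_cont by (rule continuous_on_subset) auto
  have "\<exists>g\<in>?K. \<forall>t\<in>{0<..<1}. \<forall>h\<in>?K. a t \<bullet> g \<le> a t \<bullet> h"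
    by (rule constant_unique_minimiser[OF polyhedron_discrete_couplings connected_Ioo a_cont' ex1]) simp_all
  then obtain g where g: "g \<in> ?K"
    and min: "\<And>t h. t \<in> {0<..<1} \<Longrightarrow> h \<in> ?K \<Longrightarrow> a t \<bullet> g \<le> a t \<bullet> h"
    by blast
  have "a t \<bullet> g \<le> a t \<bullet> h" if "t \<in> {0..1}" "h \<in> ?K" for t h
  proof -
    \<comment> \<open>The closure of the open interval is the whole of \<open>{0..1}\<close>, so the
      inequality extends to the endpoints by continuity of \<open>a\<close>.\<close>
    have "a t \<bullet> g - a t \<bullet> h \<le> 0"
    proof (rule continuous_le_on_closure[where f = "\<lambda>t. a t \<bullet> g - a t \<bullet> h"])
      show "continuous_on (closure {0<..<1}) (\<lambda>t. a t \<bullet> g - a t \<bullet> h)"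
        using a_cont by (auto intro!: continuous_intros)
    qed (use that min in auto)
    then show ?thesis
      by simp
  qed
  then have "?opt t (config_plan g (X t) (Y t))" if "t \<in> {0..1}" for t
    unfolding opt_iff using g that by blast
  \<comment> \<open>At the endpoints the minimising matrix need not be unique, but the hypothesis
    \<open>unique\<close> concerns the plan, and that is enough.\<close>
  then have opt: "?opt t \<gamma> \<longleftrightarrow> \<gamma> = config_plan g (X t) (Y t)" if "t \<in> {0..1}" for t \<gamma>
    using unique[OF that] that by blast
  \<comment> \<open>By \<open>opt\<close> the plans at \<open>s\<close> and \<open>t\<close> come
    from the same matrix \<open>g\<close>, so the gluing lemma applies to this pair of
    times.\<close>
  show ?thesis
    using g opt glue_composition_config_plan[OF g alpha_sum]
    by (auto intro!: bexI[of _ g] config_transition_coupling)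
qed

end
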